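(* The Lie algebra of $\mathrm{Iso}_{\mathrm{sub}}(\mathbb{S}^7_{\mathrm{T},4})\cap O(8)$ coincides with $$\mathfrak{h}_5=\mathrm{span}_{\mathbb{R}}\{A_iA_j : 1\le i<j\le4 \text{ or } 5\le i<j\le7\}\subset\mathfrak{so}(8).$$ In particular, $\dim\mathrm{Iso}_{\mathrm{sub}}(\mathbb{S}^7_{\mathrm{T},4})\ge\dim\mathfrak{h}_5=9$.
   Context: Let $A_1,\dots,A_7\in\mathfrak{so}(8)$ be a fixed family of real skew-symmetric $8\times 8$ matrices with $A_iA_j+A_jA_i=-2\delta_{ij}I$ for $i,j=1,\dots,7$. $\mathbb{S}^7\subset\mathbb{R}^8$ is the unit sphere. $\mathbb{S}^7_{\mathrm{T},4}=(\mathbb{S}^7,\mathcal{D}_4,g)$ is the subriemannian (SR) manifold with distribution $(\mathcal{D}_4)_q=\mathrm{span}\{A_1q,\dots,A_4q\}\subset T_q\mathbb{S}^7$ and $g$ the restriction to $\mathcal{D}_4$ of the standard Riemannian metric of $\mathbb{S}^7$. An SR isometry of an SR manifold $(M,\mathcal{H},g)$ is a diffeomorphism $\Phi:M\to M$ with $d\Phi_q(\mathcal{H}_q)\subset\mathcal{H}_{\Phi(q)}$ and such that $d\Phi_q:(\mathcal{H}_q,g_q)\to(\mathcal{H}_{\Phi(q)},g_{\Phi(q)})$ is an isometry for every $q\in M$. $\mathrm{Iso}_{\mathrm{sub}}(M)$ denotes the group of all SR isometries, which for the structures considered here is a Lie group. $O(8)$ acts on $\mathbb{S}^7$ by left multiplication,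 and its elements are identified with the induced diffeomorphisms of $\mathbb{S}^7$; the intersection $\mathrm{Iso}_{\mathrm{sub}}(\mathbb{S}^7_{\mathrm{T},4})\cap O(8)$ is a closed (Lie) subgroup of $O(8)$. *)

theory Defs
  imports "HOL-Analysis.Analysis" "HOL-Library.Extended_Nat"
begin

primrec Ck_on :: "nat \<Rightarrow> 'a::real_normed_vector set \<Rightarrow> ('a \<Rightarrow> 'b::real_normed_vector) \<Rightarrow> bool" where
  "Ck_on 0 U f \<longleftrightarrow> continuous_on U f"
| "Ck_on (Suc k) U f \<longleftrightarrow>
     (\<forall>x\<in>U. f differentiable (at x)) \<and>
     (\<forall>v. Ck_on k U (\<lambda>x. frechet_derivative f (at x) v))"

text \<open>The sphere is a closed embedded submanifold, so a map on it is smooth iff it is the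
  restriction of a smooth map on an open neighbourhood. Maps of the sphere are represented by total
  functions on the ambient space; all notions below depend only on their values on the sphere.\<close>

definition smooth_on_sphere ::
    "('a::euclidean_space \<Rightarrow> 'b::real_normed_vector) \<Rightarrow> bool" where
  "smooth_on_sphere f \<longleftrightarrow>
     (\<exists>U F. open U \<and> sphere 0 1 \<subseteq> U \<and> (\<forall>k. Ck_on k U F) \<and> (\<forall>q\<in>sphere 0 1. F q = f q))"

definition sphere_diffeo :: "('a::euclidean_space \<Rightarrow> 'a) \<Rightarrow> bool" where
  "sphere_diffeo \<Phi> \<longleftrightarrow>
     bij_betw \<Phi> (sphere 0 1) (sphere 0 1) \<and>
     smooth_on_sphere \<Phi> \<and> smooth_on_sphere (inv_into (sphere 0 1) \<Phi>)"

text \<open>A subriemannian structure on the unit sphere, whose metric is the restriction of the standard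
  one, is given by its distribution \<open>H\<close>, with \<open>H q\<close> a subspace of the tangent space at \<open>q\<close>.
  A derivative \<open>D\<close> of \<open>\<Phi>\<close> at \<open>q\<close> within the sphere is determined only on tangent vectors at \<open>q\<close>,
  where it is the differential of \<open>\<Phi>\<close>; it is evaluated only there.\<close>

definition sr_isometry :: "('a::euclidean_space \<Rightarrow> 'a set) \<Rightarrow> ('a \<Rightarrow> 'a) \<Rightarrow> bool" where
  "sr_isometry H \<Phi> \<longleftrightarrow>
     sphere_diffeo \<Phi> \<and>
     (\<forall>q\<in>sphere 0 1. \<exists>D. (\<Phi> has_derivative D) (at q within sphere 0 1) \<and>
        D ` H q \<subseteq> H (\<Phi> q) \<and>
        (\<forall>u\<in>H q. \<forall>v\<in>H q. D u \<bullet> D v = u \<bullet> v))"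

definition sr_isometries_orthogonal ::
    "(real^'n \<Rightarrow> (real^'n) set) \<Rightarrow> (real^'n^'n) set" where
  "sr_isometries_orthogonal H = {Q. orthogonal_matrix Q \<and> sr_isometry H (\<lambda>q. Q *v q)}"

text \<open>The multiplication of the type class instance for \<open>real^'n^'n\<close> is componentwise, so
  the exponential series is written with the matrix product \<open>**\<close>.\<close>

definition mat_exp :: "real^'n^'n \<Rightarrow> real^'n^'n" where
  "mat_exp X = (\<Sum>k. (1 / fact k) *\<^sub>R (((**) X ^^ k) (mat 1)))"

text \<open>Lie algebra of a closed subgroup of the general linear group.\<close>

definition matrix_lie_algebra :: "(real^'n^'n) set \<Rightarrow> (real^'n^'n) set" where
  "matrix_lie_algebra G = {X. \<forall>t::real. mat_exp (t *\<^sub>R X) \<in> G}"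

definition so_algebra :: "(real^'n^'n) set" where
  "so_algebra = {X. transpose X = - X}"

text \<open>The Lie algebra of the Lie group of all subriemannian isometries: its elements are the
  generators of the one-parameter subgroups, i.e. the smooth vector fields on the sphere
  whose flow is global and consists of subriemannian isometries.\<close>

definition sr_killing_field ::
    "('a::euclidean_space \<Rightarrow> 'a set) \<Rightarrow> ('a \<Rightarrow> 'a) \<Rightarrow> bool" where
  "sr_killing_field H V \<longleftrightarrow>
     smooth_on_sphere V \<and>
     (\<exists>\<phi>::real \<Rightarrow> 'a \<Rightarrow> 'a.
        (\<forall>t. sr_isometry H (\<phi> t)) \<and>
        (\<forall>q\<in>sphere 0 1. \<phi> 0 q = q) \<and>
        (\<forall>s t. \<forall>q\<in>sphere 0 1. \<phi> (s + t) q = \<phi> s (\<phi> t q)) \<and>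
        (\<forall>t. \<forall>q\<in>sphere 0 1. ((\<lambda>t. \<phi> t q) has_vector_derivative V (\<phi> t q)) (at t)))"

text \<open>The dimension of the isometry group is the dimension of its Lie algebra: the supremum of all
  \<open>n\<close> for which there are \<open>n\<close> Killing fields that are linearly independent as functions on the
  sphere. It takes values in \<^typ>\<open>enat\<close> so that an infinite dimension would not
  collapse to \<open>0\<close>.\<close>

definition sr_isometry_group_dim :: "('a::euclidean_space \<Rightarrow> 'a set) \<Rightarrow> enat" where
  "sr_isometry_group_dim H =
     (SUP n \<in> {n. \<exists>V::nat \<Rightarrow> 'a \<Rightarrow> 'a.
         (\<forall>i<n. sr_killing_field H (V i)) \<and>
         (\<forall>c::nat \<Rightarrow> real. (\<forall>q\<in>sphere 0 1. (\<Sum>i<n. c i *\<^sub>R V i q) = 0) \<longrightarrow> (\<forall>i<n. c i = 0))}.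
       enat n)"

definition clifford_family :: "(nat \<Rightarrow> real^8^8) \<Rightarrow> bool" where
  "clifford_family A \<longleftrightarrow>
     (\<forall>i\<in>{1..7}. A i \<in> so_algebra) \<and>
     (\<forall>i\<in>{1..7}. \<forall>j\<in>{1..7}.
        A i ** A j + A j ** A i = (if i = j then - 2 else 0) *\<^sub>R mat 1)"

definition dist4 :: "(nat \<Rightarrow> real^8^8) \<Rightarrow> real^8 \<Rightarrow> (real^8) set" where
  "dist4 A q = span {A i *v q | i. i \<in> {1..4}}"

definition h5 :: "(nat \<Rightarrow> real^8^8) \<Rightarrow> (real^8^8) set" where
  "h5 A = span {A i ** A j | i j. (1 \<le> i \<and> i < j \<and> j \<le> 4) \<or> (5 \<le> i \<and> i < j \<and> j \<le> 7)}"

end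

theory Submission
  imports Defs
begin

text \<open>For \<open>X\<close> in \<open>h5\<close> the commutator with \<open>X\<close> maps the span of
  \<open>A 1, \<dots>, A 4\<close> to itself, hence so does conjugation by \<open>exp (t X)\<close>, and
  \<open>exp (t X)\<close> preserves the distribution. Conversely, if all \<open>exp (t X)\<close> preserve the
  distribution, then \<open>exp (t X) A\<^sub>m q\<close> is orthogonal to \<open>A\<^sub>k exp (t X) q\<close> for
  \<open>m \<le> 4 < k\<close>; the derivative at \<open>t = 0\<close> says that
  \<open>A\<^sub>k X A\<^sub>m + A\<^sub>m A\<^sub>k X\<close> is skew. Pairing it with the symmetric matrices \<open>1\<close> and
  \<open>A\<^sub>k A\<^sub>i A\<^sub>m\<close> shows that \<open>X\<close> is orthogonal to \<open>A\<^sub>m A\<^sub>k\<close> and to \<open>A\<^sub>i\<close>.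
  Since the 28 matrices \<open>A\<^sub>i\<close>, \<open>A\<^sub>i A\<^sub>j\<close> form an orthogonal basis of the skew matrices,
  only the generators of \<open>h5\<close> remain in the expansion of \<open>X\<close>.\<close>

subsection \<open>The Frobenius inner product\<close>

text \<open>Boundedness is automatic in finite dimension. It makes the product rule and the passage
  through convergent series available for \<open>**\<close>.\<close>

lemma bounded_bilinear_matrix_mult:
  "bounded_bilinear ((**) :: real^'n^'m \<Rightarrow> real^'p^'n \<Rightarrow> real^'p^'m)"
  unfolding bilinear_conv_bounded_bilinear[symmetric] bilinear_def
  by (auto intro!: linearI simp: matrix_matrix_mult_def vec_eq_iff sum.distrib
      distrib_left distrib_right sum_distrib_left mult_ac)

lemma bounded_bilinear_matrix_vector_mult:
  "bounded_bilinear ((*v) :: real^'n^'m \<Rightarrow> real^'n \<Rightarrow> real^'m)"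
  unfolding bilinear_conv_bounded_bilinear[symmetric] bilinear_def
  by (auto intro!: linearI simp: algebra_simps scaleR_matrix_vector_assoc[symmetric])

interpretation mm: bounded_bilinear "(**) :: real^'n^'m \<Rightarrow> real^'p^'n \<Rightarrow> real^'p^'m"
  by (rule bounded_bilinear_matrix_mult)

interpretation mv: bounded_bilinear "(*v) :: real^'n^'m \<Rightarrow> real^'n \<Rightarrow> real^'m"
  by (rule bounded_bilinear_matrix_vector_mult)

lemma bounded_linear_transpose: "bounded_linear (transpose :: real^'n^'m \<Rightarrow> real^'m^'n)"
  unfolding linear_conv_bounded_linear[symmetric]
  by (rule linearI) (simp_all add: transpose_def vec_eq_iff)

text \<open>The componentwise inner product is the trace form tr(X^T Y), for which the transpose
  gives the adjoint. The proof only reorders a triple sum.\<close>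

lemma inner_matrix_mult_left:
  fixes M :: "real^'n^'m" and X :: "real^'p^'n"
  shows "(M ** X) \<bullet> Y = X \<bullet> (transpose M ** Y)"
proof -
  have "(M ** X) \<bullet> Y = (\<Sum>i\<in>UNIV. \<Sum>j\<in>UNIV. \<Sum>k\<in>UNIV. M $ i $ k * X $ k $ j * Y $ i $ j)"
    by (simp add: inner_vec_def matrix_matrix_mult_def sum_distrib_right)
  also have "\<dots> = (\<Sum>i\<in>UNIV. \<Sum>k\<in>UNIV. \<Sum>j\<in>UNIV. M $ i $ k * X $ k $ j * Y $ i $ j)"
    by (rule sum.cong[OF refl], rule sum.swap)
  also have "\<dots> = (\<Sum>k\<in>UNIV. \<Sum>i\<in>UNIV. \<Sum>j\<in>UNIV. M $ i $ k * X $ k $ j * Y $ i $ j)"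
    by (rule sum.swap)
  also have "\<dots> = (\<Sum>k\<in>UNIV. \<Sum>j\<in>UNIV. \<Sum>i\<in>UNIV. M $ i $ k * X $ k $ j * Y $ i $ j)"
    by (rule sum.cong[OF refl], rule sum.swap)
  also have "\<dots> = X \<bullet> (transpose M ** Y)"
    by (simp add: inner_vec_def matrix_matrix_mult_def sum_distrib_left transpose_def algebra_simps)
  finally show ?thesis .
qed

lemma inner_transpose: "transpose X \<bullet> transpose Y = X \<bullet> (Y :: real^'n^'m)"
  unfolding inner_vec_def transpose_def by (simp, rule sum.swap)

lemma inner_matrix_mult_right:
  fixes M :: "real^'p^'n" and X :: "real^'n^'m"
  shows "(X ** M) \<bullet> Y = X \<bullet> (Y ** transpose M)"
  by (subst (1 2) inner_transpose[symmetric])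
    (simp only: matrix_transpose_mul transpose_transpose inner_matrix_mult_left)

lemma inner_matrix_vector_mult:
  fixes M :: "real^'n^'m"
  shows "(M *v x) \<bullet> y = x \<bullet> (transpose M *v y)"
  by (simp add: dot_lmul_matrix inner_commute[of x] inner_commute[of _ y])

lemma inner_skew_symmetric:
  fixes M S :: "real^'n^'n"
  assumes "transpose M = - M" "transpose S = S"
  shows "M \<bullet> S = 0"
  using inner_transpose[of M S] assms by simp

text \<open>Polarization, read off at pairs of basis vectors.\<close>

lemma quadratic_form_zero_imp_skew:
  fixes M :: "real^'n^'n"
  assumes "\<And>q. (M *v q) \<bullet> q = 0"
  shows "transpose M = - M"
proof -
  have p: "(M *v x) \<bullet> y + (M *v y) \<bullet> x = 0" for x y
    using assms[of "x + y"] assms[of x] assms[of y] by (simp add: mv.add_right inner_simps)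
  have "transpose M $ i $ j = (- M) $ i $ j" for i j
    using p[of "axis i 1" "axis j 1"]
    by (simp add: matrix_vector_mult_basis column_def inner_axis transpose_def)
  then show ?thesis unfolding vec_eq_iff by blast
qed

subsection \<open>The matrix exponential\<close>

definition matrix_power :: "real^'n^'n \<Rightarrow> nat \<Rightarrow> real^'n^'n" where
  "matrix_power X k = ((**) X ^^ k) (mat 1)"

lemma matrix_power_0 [simp]: "matrix_power X 0 = mat 1"
  and matrix_power_Suc: "matrix_power X (Suc k) = X ** matrix_power X k"
  by (simp_all add: matrix_power_def)

lemma matrix_power_Suc_right: "matrix_power X (Suc k) = matrix_power X k ** X"
  by (induction k) (simp_all add: matrix_power_Suc matrix_mul_assoc)

lemma matrix_power_scaleR: "matrix_power (t *\<^sub>R X) k = t ^ k *\<^sub>R matrix_power X k"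
  by (induction k) (simp_all add: matrix_power_Suc mm.scaleR_left mm.scaleR_right mult.commute)

text \<open>The norm is used as submultiplicative up to a constant \<open>K\<close>, which is
  absorbed into the base of the geometric bound.\<close>

lemma norm_matrix_power_le:
  fixes X :: "real^'n^'n"
  shows "\<exists>c. \<forall>k. norm (matrix_power X k) \<le> norm (mat 1 :: real^'n^'n) * c ^ k"
proof -
  obtain K where K: "0 < K" "\<And>(A :: real^'n^'n) (B :: real^'n^'n). norm (A ** B) \<le> norm A * norm B * K"
    using mm.pos_bounded by blast
  have "norm (matrix_power X k) \<le> norm (mat 1 :: real^'n^'n) * (norm X * K) ^ k" for k
  proof (induction k)
    case (Suc k)
    have "norm (matrix_power X (Suc k)) \<le> (norm X * K) * norm (matrix_power X k)"
      using K(2)[of X "matrix_power X k"] by (simp add: matrix_power_Suc mult_ac)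
    also have "\<dots> \<le> (norm X * K) * (norm (mat 1 :: real^'n^'n) * (norm X * K) ^ k)"
      using Suc K(1) by (intro mult_left_mono) auto
    finally show ?case by (simp add: mult_ac)
  qed simp
  then show ?thesis by blast
qed

lemma summable_mat_exp:
  fixes X :: "real^'n^'n"
  shows "summable (\<lambda>k. norm ((1 / fact k) *\<^sub>R matrix_power (t *\<^sub>R X) k))"
proof -
  obtain c where c: "\<And>k. norm (matrix_power X k) \<le> norm (mat 1 :: real^'n^'n) * c ^ k"
    using norm_matrix_power_le by blast
  have "summable (\<lambda>k. norm (mat 1 :: real^'n^'n) * (inverse (fact k) * (\<bar>t\<bar> * c) ^ k))"
    by (intro summable_mult summable_exp)
  then show ?thesis
  proof (rule summable_comparison_test')
    fix k
    have "\<bar>t\<bar> ^ k * norm (matrix_power X k) \<le> \<bar>t\<bar> ^ k * (norm (mat 1 :: real^'n^'n) * c ^ k)"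
      by (intro mult_left_mono c) auto
    then show "norm (norm ((1 / fact k) *\<^sub>R matrix_power (t *\<^sub>R X) k))
        \<le> norm (mat 1 :: real^'n^'n) * (inverse (fact k) * (\<bar>t\<bar> * c) ^ k)"
      by (simp add: matrix_power_scaleR power_abs power_mult_distrib field_simps)
  qed
qed

lemma mat_exp_sums:
  "(\<lambda>k. (1 / fact k) *\<^sub>R matrix_power (t *\<^sub>R X) k) sums mat_exp (t *\<^sub>R X)"
  unfolding mat_exp_def matrix_power_def[symmetric]
  by (intro summable_sums summable_norm_cancel[OF summable_mat_exp])

lemma mat_exp_zero [simp]: "mat_exp 0 = mat 1"
proof -
  \<comment> \<open>Writing the zero matrix as \<open>0 *\<^sub>R mat 1\<close> lets
    \<open>matrix_power_scaleR\<close> remove every term but the first.\<close>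
  have "(\<lambda>k. (1 / fact k) *\<^sub>R matrix_power (0 *\<^sub>R mat 1) k) sums
      (\<Sum>k\<in>{0}. (1 / fact k) *\<^sub>R matrix_power (0 *\<^sub>R mat 1 :: real^'n^'n) k)"
    by (intro sums_finite) (auto simp: matrix_power_scaleR[of 0] simp del: scaleR_zero_left)
  then show ?thesis
    using mat_exp_sums[of 0 "mat 1 :: real^'n^'n"] sums_unique2 by fastforce
qed

lemma mat_exp_commute: "X ** mat_exp (t *\<^sub>R X) = mat_exp (t *\<^sub>R X) ** X"
proof -
  have "(\<lambda>k. X ** ((1 / fact k) *\<^sub>R matrix_power (t *\<^sub>R X) k)) sums (X ** mat_exp (t *\<^sub>R X))"
    by (rule bounded_linear.sums[OF mm.bounded_linear_right mat_exp_sums])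
  moreover have "(\<lambda>k. ((1 / fact k) *\<^sub>R matrix_power (t *\<^sub>R X) k) ** X) sums (mat_exp (t *\<^sub>R X) ** X)"
    by (rule bounded_linear.sums[OF mm.bounded_linear_left mat_exp_sums])
  moreover have "X ** ((1 / fact k) *\<^sub>R matrix_power (t *\<^sub>R X) k)
      = ((1 / fact k) *\<^sub>R matrix_power (t *\<^sub>R X) k) ** X" for k
    using matrix_power_Suc[of X k] matrix_power_Suc_right[of X k]
    by (simp add: matrix_power_scaleR mm.scaleR_left mm.scaleR_right)
  ultimately show ?thesis by (simp add: sums_iff)
qed

text \<open>Paired with a fixed \<open>Y\<close>, the exponential is a real power series in
  \<open>t\<close> that converges everywhere and may be differentiated term by term. The matrix
  statement follows componentwise.\<close>

lemma mat_exp_has_vector_derivative: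
  fixes X :: "real^'n^'n"
  shows "((\<lambda>t. mat_exp (t *\<^sub>R X)) has_vector_derivative X ** mat_exp (t *\<^sub>R X)) (at t)"
proof -
  have "((\<lambda>t. mat_exp (t *\<^sub>R X) \<bullet> Y) has_real_derivative (X ** mat_exp (t *\<^sub>R X)) \<bullet> Y) (at t)" for Y
  proof -
    define c where "c k = (1 / fact k) *\<^sub>R matrix_power X k \<bullet> Y" for k
    have s: "(\<lambda>k. c k * t ^ k) sums (mat_exp (t *\<^sub>R X) \<bullet> Y)" for t
      using bounded_linear.sums[OF bounded_linear_inner_left mat_exp_sums[of t X], of Y]
      by (simp add: c_def matrix_power_scaleR mult_ac)
    have "(\<lambda>k. (X ** ((1 / fact k) *\<^sub>R matrix_power (t *\<^sub>R X) k)) \<bullet> Y) sums ((X ** mat_exp (t *\<^sub>R X)) \<bullet> Y)"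
      by (intro bounded_linear.sums[OF bounded_linear_inner_left]
          bounded_linear.sums[OF mm.bounded_linear_right mat_exp_sums])
    moreover have "diffs c k * t ^ k = (X ** ((1 / fact k) *\<^sub>R matrix_power (t *\<^sub>R X) k)) \<bullet> Y" for k
      by (simp add: diffs_def c_def matrix_power_Suc matrix_power_scaleR mm.scaleR_right field_simps del: of_nat_Suc)
    ultimately have d: "(\<Sum>k. diffs c k * t ^ k) = (X ** mat_exp (t *\<^sub>R X)) \<bullet> Y"
      by (simp add: sums_iff)
    have "((\<lambda>t. \<Sum>k. c k * t ^ k) has_real_derivative (\<Sum>k. diffs c k * t ^ k)) (at t)"
      by (rule termdiffs_strong_converges_everywhere) (use s in \<open>blast intro: sums_summable\<close>)
    then show ?thesis using s d by (simp add: sums_iff)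
  qed
  then show ?thesis
    unfolding has_vector_derivative_def
    by (subst has_derivative_componentwise_within)
      (simp add: has_field_derivative_def mult.commute[of _ "_ \<bullet> _"])
qed

section \<open>One-parameter groups of matrices and orthogonality\<close>

lemma vector_derivative_zero_imp_constant:
  fixes f :: "real \<Rightarrow> 'a::real_normed_vector"
  assumes "\<And>t. (f has_vector_derivative 0) (at t)"
  shows "f s = f t"
proof -
  have "(f has_derivative (\<lambda>h. 0)) (at x within UNIV)" for x
    using assms[of x] by (simp add: has_vector_derivative_def)
  from has_derivative_zero_constant[OF convex_UNIV this] show ?thesis by auto
qed

lemma mat_exp_shift_has_vector_derivative:
  "((\<lambda>t. mat_exp ((s + t) *\<^sub>R X)) has_vector_derivative X ** mat_exp ((s + t) *\<^sub>R X)) (at t)"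
proof -
  have "((\<lambda>t. s + t) has_vector_derivative 1) (at t)" by (auto intro!: derivative_eq_intros)
  from vector_diff_chain_at[OF this mat_exp_has_vector_derivative] show ?thesis by (simp add: o_def)
qed

lemma mat_exp_minus_has_vector_derivative:
  "((\<lambda>t. mat_exp (- t *\<^sub>R X)) has_vector_derivative - (X ** mat_exp (- t *\<^sub>R X))) (at t)"
proof -
  have "((\<lambda>t. - t) has_vector_derivative - 1) (at t)" by (auto intro!: derivative_eq_intros)
  from vector_diff_chain_at[OF this mat_exp_has_vector_derivative] show ?thesis by (simp add: o_def)
qed

text \<open>The left side is constant in \<open>t\<close> because \<open>X\<close> commutes with its
  exponentials, and \<open>t = 0\<close> gives its value. The shift \<open>s\<close> makes this one
  identity yield both the inverse and the addition law.\<close>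

lemma mat_exp_shift_mult_minus: "mat_exp ((s + t) *\<^sub>R X) ** mat_exp (- t *\<^sub>R X) = mat_exp (s *\<^sub>R X)"
proof -
  let ?f = "\<lambda>t. mat_exp ((s + t) *\<^sub>R X) ** mat_exp (- t *\<^sub>R X)"
  have "(?f has_vector_derivative 0) (at t)" for t
    using mm.has_vector_derivative[OF mat_exp_shift_has_vector_derivative[of s X t]
        mat_exp_minus_has_vector_derivative[of X t]]
    by (simp only: mm.minus_right mat_exp_commute[of X "s + t"] matrix_mul_assoc ab_left_minus)
  from vector_derivative_zero_imp_constant[OF this, of t 0] show ?thesis by simp
qed

lemma mat_exp_mult_minus: "mat_exp (t *\<^sub>R X) ** mat_exp (- t *\<^sub>R X) = mat 1"
  using mat_exp_shift_mult_minus[of 0 t X] by simp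

lemma mat_exp_add: "mat_exp ((s + t) *\<^sub>R X) = mat_exp (s *\<^sub>R X) ** mat_exp (t *\<^sub>R X)"
  using mat_exp_shift_mult_minus[of s t X] mat_exp_mult_minus[of "- t" X]
  by (metis matrix_mul_assoc matrix_mul_rid minus_minus)

text \<open>With E the exponential, the derivative of E^T E is E^T (X^T + X) E = 0.\<close>

lemma orthogonal_matrix_mat_exp:
  assumes "X \<in> so_algebra"
  shows "orthogonal_matrix (mat_exp (t *\<^sub>R X))"
proof -
  let ?f = "\<lambda>t. transpose (mat_exp (t *\<^sub>R X)) ** mat_exp (t *\<^sub>R X)"
  have "(?f has_vector_derivative 0) (at t)" for t
    using mm.has_vector_derivative[OF bounded_linear.has_vector_derivative[OF bounded_linear_transpose mat_exp_has_vector_derivative[of X t]]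
        mat_exp_has_vector_derivative[of X t]] assms
    by (simp add: so_algebra_def matrix_transpose_mul matrix_mul_assoc mm.minus_right mm.minus_left)
  from vector_derivative_zero_imp_constant[OF this, of t 0] show ?thesis
    by (simp add: orthogonal_matrix)
qed

lemma orthogonal_mat_exp_imp_so_algebra:
  assumes "\<And>t. orthogonal_matrix (mat_exp (t *\<^sub>R X))"
  shows "X \<in> so_algebra"
proof -
  let ?f = "\<lambda>t. transpose (mat_exp (t *\<^sub>R X)) ** mat_exp (t *\<^sub>R X)"
  have "(?f has_vector_derivative X + transpose X) (at 0)"
    using mm.has_vector_derivative[OF bounded_linear.has_vector_derivative[OF bounded_linear_transpose mat_exp_has_vector_derivative[of X 0]]
        mat_exp_has_vector_derivative[of X 0]] by simp
  moreover have "?f = (\<lambda>t. mat 1)" using assms by (simp add: orthogonal_matrix)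
  ultimately have "X + transpose X = 0"
    by (metis has_vector_derivative_const vector_derivative_unique_at)
  then show ?thesis by (simp add: so_algebra_def add_eq_0_iff)
qed

subsection \<open>Skew-symmetric matrices\<close>

lemma subspace_so_algebra: "subspace (so_algebra :: (real^'n^'n) set)"
  using bounded_linear.linear[OF bounded_linear_transpose[where 'n = 'n and 'm = 'n]]
  by (simp add: subspace_def so_algebra_def linear_0 linear_add linear_scale)

lemma matrix_unit_expansion:
  fixes X :: "real^'n^'m"
  shows "X = (\<Sum>i\<in>UNIV. \<Sum>j\<in>UNIV. X $ i $ j *\<^sub>R axis i (axis j 1))"
proof -
  have "(\<Sum>i\<in>UNIV. \<Sum>j\<in>UNIV. X $ i $ j *\<^sub>R axis i (axis j 1)) $ k $ l = X $ k $ l" for k l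
  proof -
    have "(\<Sum>i\<in>UNIV. \<Sum>j\<in>UNIV. X $ i $ j *\<^sub>R axis i (axis j 1)) $ k $ l
        = (\<Sum>i\<in>UNIV. \<Sum>j\<in>UNIV. if l = j then if k = i then X $ i $ j else 0 else 0)"
      unfolding sum_component by (intro sum.cong refl) (auto simp: axis_def)
    also have "\<dots> = X $ k $ l" by simp
    finally show ?thesis .
  qed
  then show ?thesis by (simp add: vec_eq_iff)
qed

lemma card_less_pairs:
  "2 * card {p :: 'n \<times> 'n::{finite,linorder}. fst p < snd p} + CARD('n) = CARD('n) * CARD('n)"
proof -
  let ?L = "{p :: 'n \<times> 'n. fst p < snd p}" and ?G = "{p :: 'n \<times> 'n. snd p < fst p}"
  let ?D = "{p :: 'n \<times> 'n. fst p = snd p}"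
  have "bij_betw prod.swap ?L ?G" by (rule bij_betwI[where g = prod.swap]) auto
  then have "card ?G = card ?L" by (simp add: bij_betw_same_card)
  moreover have "bij_betw (\<lambda>x. (x, x)) (UNIV :: 'n set) ?D" by (rule bij_betwI[where g = fst]) auto
  then have "card ?D = CARD('n)" by (simp add: bij_betw_same_card)
  moreover have "card (UNIV :: ('n \<times> 'n) set) = card ?L + card ?G + card ?D"
  proof -
    have "(UNIV :: ('n \<times> 'n) set) = (?L \<union> ?G) \<union> ?D" by auto
    then have "card (UNIV :: ('n \<times> 'n) set) = card ((?L \<union> ?G) \<union> ?D)" by presburger
    also have "\<dots> = card (?L \<union> ?G) + card ?D" by (rule card_Un_disjoint) auto
    also have "card (?L \<union> ?G) = card ?L + card ?G" by (rule card_Un_disjoint) auto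
    finally show ?thesis .
  qed
  ultimately show ?thesis by (simp add: card_cartesian_product flip: UNIV_Times_UNIV)
qed

text \<open>The differences \<open>F i j\<close> of matrix units with i < j span the skew matrices.
  The 28 independent words found below turn this bound into an equality for size 8.\<close>

lemma dim_so_algebra_le:
  "2 * dim (so_algebra :: ((real, 'n) vec, 'n::{finite,linorder}) vec set) + CARD('n) \<le> CARD('n) * CARD('n)"
proof -
  define F :: "'n \<Rightarrow> 'n \<Rightarrow> ((real, 'n) vec, 'n) vec" where
    "F i j = axis i (axis j 1) - axis j (axis i 1)" for i j
  let ?L = "{p :: 'n \<times> 'n. fst p < snd p}"
  let ?B = "(\<lambda>p. F (fst p) (snd p)) ` ?L"
  have F: "F i j \<in> span ?B" for i j
  proof (cases i j rule: linorder_cases)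
    case less
    then show ?thesis by (intro span_base) (force simp: image_iff)
  next
    case equal
    then show ?thesis by (simp add: F_def span_zero)
  next
    case greater
    then have "- F i j \<in> span ?B" by (intro span_base) (force simp: image_iff F_def)
    from span_neg[OF this] show ?thesis by simp
  qed
  have "so_algebra \<subseteq> span ?B"
  proof
    fix X :: "((real, 'n) vec, 'n) vec" assume X: "X \<in> so_algebra"
    have tr: "transpose (axis i (axis j (1::real))) = axis j (axis i 1)" for i j :: 'n
      by (simp add: vec_eq_iff transpose_def axis_def)
    have lin: "linear (transpose :: ((real, 'n) vec, 'n) vec \<Rightarrow> ((real, 'n) vec, 'n) vec)"
      using bounded_linear_transpose bounded_linear.linear by blast
    \<comment> \<open>Antisymmetrizing turns the expansion of \<open>X\<close> in matrix units into
      one in the \<open>F i j\<close>.\<close>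
    have "2 *\<^sub>R X = X - transpose X" using X by (simp add: so_algebra_def scaleR_2)
    also have "transpose X = (\<Sum>i\<in>UNIV. \<Sum>j\<in>UNIV. X $ i $ j *\<^sub>R axis j (axis i 1))"
      by (subst matrix_unit_expansion[of X]) (simp add: linear_sum[OF lin] linear_scale[OF lin] tr)
    also have "X - \<dots> = (\<Sum>i\<in>UNIV. \<Sum>j\<in>UNIV. X $ i $ j *\<^sub>R F i j)"
      by (subst matrix_unit_expansion[of X]) (simp add: F_def scaleR_diff_right sum_subtractf)
    also have "\<dots> \<in> span ?B" by (intro span_sum span_scale F)
    finally have "(1/2) *\<^sub>R (2 *\<^sub>R X) \<in> span ?B" by (rule span_scale)
    then show "X \<in> span ?B" by simp
  qed
  then have "dim (so_algebra :: (((real, 'n) vec, 'n) vec) set) \<le> card ?B"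
    by (intro dim_le_card) auto
  also have "\<dots> \<le> card ?L" by (rule card_image_le) simp
  finally show ?thesis using card_less_pairs[where 'n = 'n] by linarith
qed

subsection \<open>Words in a Clifford family\<close>

locale clifford =
  fixes A :: "nat \<Rightarrow> real^8^8"
  assumes clifford: "clifford_family A"
begin

lemma transpose_A [simp]: "i \<in> {1..7} \<Longrightarrow> transpose (A i) = - A i"
  using clifford by (auto simp: clifford_family_def so_algebra_def)

lemma A_square: "i \<in> {1..7} \<Longrightarrow> A i ** A i = - mat 1"
proof -
  assume "i \<in> {1..7}"
  then have "2 *\<^sub>R (A i ** A i) = 2 *\<^sub>R (- mat 1)"
    using clifford unfolding clifford_family_def by (simp add: scaleR_2)
  then show ?thesis by (simp only: scaleR_cancel_left) simp
qed

lemma A_anticommute: "i \<in> {1..7} \<Longrightarrow> j \<in> {1..7} \<Longrightarrow> i \<noteq> j \<Longrightarrow> A i ** A j = - (A j ** A i)"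
  using clifford unfolding clifford_family_def by (simp add: eq_neg_iff_add_eq_0)

text \<open>The primed rules carry a tail \<open>Z\<close>, so that the Clifford relations can
  rewrite inside right-nested products.\<close>

lemma A_square': "i \<in> {1..7} \<Longrightarrow> A i ** (A i ** Z) = - Z"
  by (simp only: matrix_mul_assoc A_square mm.minus_left matrix_mul_lid)

lemma A_anticommute':
  assumes "i \<in> {1..7}" "j \<in> {1..7}" "i \<noteq> j"
  shows "A i ** (A j ** Z) = - (A j ** (A i ** Z))"
  by (simp only: matrix_mul_assoc A_anticommute[OF assms] mm.minus_left)

lemmas A_word = A_square A_square' mm.minus_left mm.minus_right matrix_mul_assoc[symmetric]

text \<open>A pair \<open>(j, i)\<close> with \<open>i < j \<le> 7\<close> stands for \<open>A i ** A j\<close>, and for \<open>A j\<close> if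
  \<open>i = 0\<close>. Two different words are orthogonal because some conjugation by an \<open>A l\<close> fixes
  one and negates the other.\<close>

definition word :: "nat \<times> nat \<Rightarrow> real^8^8" where
  "word p = (if snd p = 0 then A (fst p) else A (snd p) ** A (fst p))"

definition pairs :: "(nat \<times> nat) set" where
  "pairs = (SIGMA j:{..7}. {..<j})"

text \<open>The indices of the generators of \<open>h5\<close>: six pairs within 1..4 and three
  within 5..7.\<close>

definition pairs5 :: "(nat \<times> nat) set" where
  "pairs5 = (SIGMA j:{2..4}. {1..<j}) \<union> (SIGMA j:{6..7}. {5..<j})"

lemma finite_pairs [simp]: "finite pairs"
  by (simp add: pairs_def)

lemma card_pairs: "card pairs = 28"
proof -
  have "card pairs = (\<Sum>j\<le>7::nat. card {..<j})"
    unfolding pairs_def by (rule card_SigmaI) auto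
  also have "{..7::nat} = {0, 1, 2, 3, 4, 5, 6, 7}" by auto
  finally show ?thesis by simp
qed

lemma pairs5_subset: "pairs5 \<subseteq> pairs"
  by (auto simp: pairs_def pairs5_def)

lemma card_pairs5: "card pairs5 = 9"
proof -
  have "card pairs5 = card (SIGMA j:{2..4::nat}. {1..<j}) + card (SIGMA j:{6..7::nat}. {5..<j})"
    unfolding pairs5_def by (rule card_Un_disjoint) auto
  also have "card (SIGMA j:{2..4::nat}. {1..<j}) = (\<Sum>j\<in>{2..4::nat}. card {1..<j})"
    by (rule card_SigmaI) auto
  also have "card (SIGMA j:{6..7::nat}. {5..<j}) = (\<Sum>j\<in>{6..7::nat}. card {5..<j})"
    by (rule card_SigmaI) auto
  also have "{2..4::nat} = {2, 3, 4}" by auto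
  also have "{6..7::nat} = {6, 7}" by auto
  finally show ?thesis by simp
qed

lemma word_cases:
  assumes "p \<in> pairs"
  obtains j where "j \<in> {1..7}" "p = (j, 0)" "word p = A j"
  | i j where "i \<in> {1..7}" "j \<in> {1..7}" "i < j" "p = (j, i)" "word p = A i ** A j"
  using assms by (cases "snd p = 0") (auto simp: pairs_def word_def)

section \<open>Orthogonality of the words\<close>

text \<open>\<open>A l\<close> is orthogonal with inverse \<open>- A l\<close>, so X \<mapsto>
  \<open>A l ** X ** A l\<close> is conjugation up to sign and an isometry.\<close>

lemma inner_conjugate:
  assumes "l \<in> {1..7}"
  shows "(A l ** X ** A l) \<bullet> (A l ** Y ** A l) = X \<bullet> Y"
  by (subst inner_matrix_mult_right, subst inner_matrix_mult_left) (use assms in \<open>simp add: A_word\<close>)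

text \<open>Moving the right factor \<open>A l\<close> to the left costs a sign for each letter
  other than \<open>A l\<close>, and the square of \<open>A l\<close> costs one more. Hence a word
  is fixed when an odd number of its letters differ from \<open>A l\<close>, and negated otherwise;
  this also explains \<open>conjugate_AA\<close>.\<close>

lemma conjugate_A:
  assumes "l \<in> {1..7}" "j \<in> {1..7}"
  shows "A l ** A j ** A l = (if l = j then - A j else A j)"
  using assms by (auto simp: A_word A_anticommute[of j l])

lemma conjugate_AA:
  assumes "l \<in> {1..7}" "i \<in> {1..7}" "j \<in> {1..7}" "i \<noteq> j"
  shows "A l ** (A i ** A j) ** A l = (if l = i \<or> l = j then A i ** A j else - (A i ** A j))"
proof (cases "l = i \<or> l = j")
  case True
  then show ?thesis using assms by (auto simp: A_word A_anticommute[of i j])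
next
  case False
  then show ?thesis using assms by (simp add: A_word A_anticommute[of j l] A_anticommute'[of i l])
qed

lemma orthogonal_of_conjugate_signs:
  assumes "l \<in> {1..7}" "A l ** X ** A l = X" "A l ** Y ** A l = - Y"
  shows "X \<bullet> Y = 0"
  using inner_conjugate[OF assms(1), of X Y] assms by simp

lemma inner_A: "i \<in> {1..7} \<Longrightarrow> j \<in> {1..7} \<Longrightarrow> i \<noteq> j \<Longrightarrow> A i \<bullet> A j = 0"
  by (rule orthogonal_of_conjugate_signs[of j]) (auto simp: conjugate_A)

lemma inner_A_self: "i \<in> {1..7} \<Longrightarrow> A i \<bullet> A i = mat 1 \<bullet> (mat 1 :: real^8^8)"
  using inner_matrix_mult_left[of "A i" "mat 1" "A i"] by (simp add: A_word)

lemma inner_A_AA: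
  assumes "i \<in> {1..7}" "j \<in> {1..7}" "k \<in> {1..7}" "i < j"
  shows "A k \<bullet> (A i ** A j) = 0"
proof -
  \<comment> \<open>Three indices cannot exhaust 1..4. Conjugation by an \<open>A l\<close> with a
    missing index fixes \<open>A k\<close> and negates \<open>A i ** A j\<close>.\<close>
  have "\<not> {1..4} \<subseteq> {i, j, k}"
    using card_mono[of "{i, j, k}" "{1..4}"] by (auto simp: card_insert_if split: if_splits)
  then obtain l where "l \<in> {1..4}" "l \<noteq> i" "l \<noteq> j" "l \<noteq> k" by blast
  then show ?thesis using assms
    by (intro orthogonal_of_conjugate_signs[of l]) (auto simp: conjugate_A conjugate_AA)
qed

lemma inner_AA_AA:
  assumes "i \<in> {1..7}" "j \<in> {1..7}" "k \<in> {1..7}" "m \<in> {1..7}" "i < j" "k < m" "i \<noteq> k \<or> j \<noteq> m"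
  shows "(A i ** A j) \<bullet> (A k ** A m) = 0"
proof -
  \<comment> \<open>Of two different pairs, one index of the first lies outside the second.
    Conjugation by that letter fixes the first word and negates the second.\<close>
  have "(i \<noteq> k \<and> i \<noteq> m) \<or> (j \<noteq> k \<and> j \<noteq> m)" using assms by linarith
  then show ?thesis
  proof
    assume "i \<noteq> k \<and> i \<noteq> m"
    with assms show ?thesis
      by (intro orthogonal_of_conjugate_signs[of i]) (auto simp: conjugate_AA)
  next
    assume "j \<noteq> k \<and> j \<noteq> m"
    with assms show ?thesis
      by (intro orthogonal_of_conjugate_signs[of j]) (auto simp: conjugate_AA)
  qed
qed

lemma inner_word:
  assumes "p \<in> pairs" "r \<in> pairs" "p \<noteq> r"
  shows "word p \<bullet> word r = 0"
  using assms(1)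
proof (cases rule: word_cases)
  case (1 j)
  from assms(2) show ?thesis
    by (cases rule: word_cases) (use 1 assms(3) in \<open>auto simp: inner_A inner_A_AA\<close>)
next
  case (2 i j)
  from assms(2) show ?thesis
    by (cases rule: word_cases)
      (use 2 assms(3) in \<open>auto simp: inner_A_AA inner_AA_AA inner_commute[of _ "A _"]\<close>)
qed

text \<open>Every word squares to minus the identity.\<close>

lemma word_nonzero: "p \<in> pairs \<Longrightarrow> word p \<noteq> 0"
proof
  assume "p \<in> pairs" "word p = 0"
  have "word p ** word p = - mat 1"
    using \<open>p \<in> pairs\<close>
  proof (cases rule: word_cases)
    case (2 i j)
    then show ?thesis by (simp add: A_word A_anticommute'[of j i])
  qed (simp add: A_word)
  then have "mat 1 = (0 :: real^8^8)" using \<open>word p = 0\<close> by (simp add: mm.zero_left)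
  then have "(mat 1 :: real^8^8) $ 1 $ 1 = (0 :: real^8^8) $ 1 $ 1" by (rule arg_cong)
  then show False by (simp add: mat_def)
qed

lemma inj_on_word: "inj_on word pairs"
proof (rule inj_onI, rule ccontr)
  fix p r assume "p \<in> pairs" "r \<in> pairs" "word p = word r" "p \<noteq> r"
  then have "word p \<bullet> word p = 0" using inner_word[of p r] by simp
  then show False using word_nonzero[OF \<open>p \<in> pairs\<close>] by simp
qed

lemma independent_word: "independent (word ` pairs)"
  by (rule pairwise_orthogonal_independent)
    (auto simp: pairwise_def orthogonal_def intro!: inner_word dest: word_nonzero[THEN not_sym])

lemma AA_in_so_algebra:
  "i \<in> {1..7} \<Longrightarrow> j \<in> {1..7} \<Longrightarrow> i \<noteq> j \<Longrightarrow> A i ** A j \<in> so_algebra"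
  by (simp add: so_algebra_def matrix_transpose_mul mm.minus_left mm.minus_right A_anticommute[of j i])

lemma word_in_so_algebra: "p \<in> pairs \<Longrightarrow> word p \<in> so_algebra"
  by (cases rule: word_cases) (auto simp: AA_in_so_algebra, auto simp: so_algebra_def)

text \<open>There are 28 independent words in a space of dimension at most 8 * 7 / 2 = 28.\<close>

lemma span_word: "span (word ` pairs) = so_algebra"
proof -
  have "dim (so_algebra :: (real^8^8) set) \<le> card (word ` pairs)"
    using dim_so_algebra_le[where 'n = 8] by (simp add: card_image[OF inj_on_word] card_pairs)
  then have "so_algebra \<subseteq> span (word ` pairs)"
    by (intro card_ge_dim_independent independent_word) (auto simp: word_in_so_algebra)
  moreover have "span (word ` pairs) \<subseteq> so_algebra"
    by (intro span_minimal subspace_so_algebra) (auto simp: word_in_so_algebra)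
  ultimately show ?thesis by blast
qed

section \<open>The space \<open>h5\<close>: dimension, membership, commutators\<close>

lemma h5_eq_span_word: "h5 A = span (word ` pairs5)"
proof -
  have "{A i ** A j | i j. (1 \<le> i \<and> i < j \<and> j \<le> 4) \<or> (5 \<le> i \<and> i < j \<and> j \<le> 7)} = word ` pairs5"
    (is "?L = ?R")
  proof
    show "?L \<subseteq> ?R"
    proof
      fix X assume "X \<in> ?L"
      then obtain i j where "X = A i ** A j"
        "(1 \<le> i \<and> i < j \<and> j \<le> 4) \<or> (5 \<le> i \<and> i < j \<and> j \<le> 7)" by blast
      then show "X \<in> ?R"
        by (intro image_eqI[of _ _ "(j, i)"]) (auto simp: word_def pairs5_def)
    qed
    show "?R \<subseteq> ?L" by (force simp: word_def pairs5_def)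
  qed
  then show ?thesis by (simp add: h5_def)
qed

lemma dim_h5: "dim (h5 A) = 9"
proof -
  have "independent (word ` pairs5)"
    by (rule independent_mono[OF independent_word]) (use pairs5_subset in auto)
  moreover have "card (word ` pairs5) = 9"
    using card_image[OF inj_on_subset[OF inj_on_word pairs5_subset]] card_pairs5 by simp
  ultimately show ?thesis by (simp add: h5_eq_span_word dim_eq_card_independent)
qed

lemma h5_subset_so_algebra: "h5 A \<subseteq> so_algebra"
  unfolding h5_eq_span_word
  by (intro span_minimal subspace_so_algebra) (use pairs5_subset word_in_so_algebra in auto)

text \<open>The last two hypotheses cover exactly the words outside \<open>pairs5\<close>. In the
  decomposition of \<open>X\<close> along \<open>h5\<close>, the remainder \<open>Z\<close> is then
  orthogonal to all words; being skew it lies in their span, so it vanishes.\<close>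

lemma mem_h5I:
  assumes X: "X \<in> so_algebra"
    and "\<And>i. i \<in> {1..7} \<Longrightarrow> X \<bullet> A i = 0"
    and "\<And>m k. m \<in> {1..4} \<Longrightarrow> k \<in> {5..7} \<Longrightarrow> X \<bullet> (A m ** A k) = 0"
  shows "X \<in> h5 A"
proof -
  obtain Y Z where Y: "Y \<in> span (word ` pairs5)"
    and Z: "\<And>w. w \<in> span (word ` pairs5) \<Longrightarrow> orthogonal Z w" and XYZ: "X = Y + Z"
    by (rule orthogonal_subspace_decomp_exists[of "word ` pairs5" X]) auto
  have Y_perp: "Y \<bullet> word p = 0" if "p \<in> pairs - pairs5" for p
  proof -
    have "orthogonal (word p) Y"
      by (rule orthogonal_to_span[OF Y])
        (use that pairs5_subset in \<open>auto simp: orthogonal_def intro!: inner_word\<close>)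
    then show ?thesis by (simp add: orthogonal_def inner_commute)
  qed
  have X_perp: "X \<bullet> word p = 0" if "p \<in> pairs - pairs5" for p
  proof -
    from that have "p \<in> pairs" by simp
    then show ?thesis
    proof (cases rule: word_cases)
      case (2 i j)
      then have "i \<in> {1..4}" "j \<in> {5..7}" using that by (auto simp: pairs5_def)
      then show ?thesis using 2 assms(3) by simp
    qed (use assms(2) in simp)
  qed
  have "orthogonal Z (word p)" if "p \<in> pairs" for p
  proof (cases "p \<in> pairs5")
    case True
    then show ?thesis by (intro Z span_base) simp
  next
    case False
    then have "Z \<bullet> word p = 0"
      using X_perp[of p] Y_perp[of p] that XYZ by (simp add: inner_add_left)
    then show ?thesis by (simp add: orthogonal_def)
  qed
  moreover have "Z \<in> span (word ` pairs)"
  proof -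
    have "Y \<in> so_algebra" using Y h5_subset_so_algebra by (auto simp: h5_eq_span_word)
    then have "X - Y \<in> so_algebra" using X subspace_so_algebra by (rule_tac subspace_diff)
    then show ?thesis using XYZ span_word by simp
  qed
  ultimately have "orthogonal Z Z" by (intro orthogonal_to_span[of Z "word ` pairs"]) auto
  then show ?thesis using Y XYZ by (simp add: orthogonal_self h5_eq_span_word)
qed

text \<open>A generator \<open>A i ** A j\<close> commutes with \<open>A m\<close> unless m is i or
  j. Otherwise the commutator is 2 or -2 times the other letter, whose index is again in 1..4
  because i and j lie in the same block.\<close>

lemma commutator_h5_A:
  assumes "X \<in> h5 A" "m \<in> {1..4}"
  shows "X ** A m - A m ** X \<in> span (A ` {1..4})"
  using assms(1) unfolding h5_def
proof (induction rule: span_induct_alt)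
  case base
  then show ?case by (simp add: mm.zero_left mm.zero_right span_zero)
next
  case (step c x y)
  then obtain i j where x: "x = A i ** A j"
    and ij: "(1 \<le> i \<and> i < j \<and> j \<le> 4) \<or> (5 \<le> i \<and> i < j \<and> j \<le> 7)" by blast
  have r: "i \<in> {1..7}" "j \<in> {1..7}" "m \<in> {1..7}" "i \<noteq> j" using ij assms(2) by auto
  have "x ** A m - A m ** x \<in> span (A ` {1..4})"
  proof (cases "m = i \<or> m = j")
    case True
    then consider "m = i" "j \<in> {1..4}" | "m = j" "i \<in> {1..4}" using ij assms(2) by force
    then show ?thesis
    proof cases
      case 1
      then have "x ** A m - A m ** x = 2 *\<^sub>R A j"
        using r by (simp add: x A_word A_anticommute[of j i] scaleR_2)
      moreover have "A j \<in> span (A ` {1..4})" using 1 by (intro span_base imageI)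
      ultimately show ?thesis by (simp only: span_scale)
    next
      case 2
      then have "x ** A m - A m ** x = (- 2) *\<^sub>R A i"
        using r by (simp add: x A_word A_anticommute'[of j i] scaleR_2)
      moreover have "A i \<in> span (A ` {1..4})" using 2 by (intro span_base imageI)
      ultimately show ?thesis by (simp only: span_scale)
    qed
  next
    case False
    then have "x ** A m - A m ** x = 0"
      using r by (simp add: x A_word A_anticommute[of j m] A_anticommute'[of i m])
    then show ?thesis by (simp add: span_zero)
  qed
  then have "c *\<^sub>R (x ** A m - A m ** x) + (y ** A m - A m ** y) \<in> span (A ` {1..4})"
    using step by (intro span_add span_scale) auto
  then show ?case
    by (simp add: mm.add_left mm.add_right mm.scaleR_left mm.scaleR_right algebra_simps)
qed

text \<open>Moving factors across the inner product gives X \<bullet> (A_k S A_m + A_k A_m S) = 0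
  for symmetric S. The bracket is 2 A_k A_m for S = 1, and 2 A_i for S = A_k A_i A_m.\<close>

lemma orthogonal_of_skew:
  assumes "k \<in> {1..7}" "m \<in> {1..7}" "k \<noteq> m"
    and skew: "transpose (A k ** X ** A m + A m ** A k ** X) = - (A k ** X ** A m + A m ** A k ** X)"
  shows "X \<bullet> (A m ** A k) = 0"
    and "i \<in> {1..7} \<Longrightarrow> i \<noteq> k \<Longrightarrow> i \<noteq> m \<Longrightarrow> X \<bullet> A i = 0"
proof -
  have *: "X \<bullet> (A k ** S ** A m) + X \<bullet> (A k ** A m ** S) = 0" if "transpose S = S" for S
  proof -
    have "(A k ** X ** A m) \<bullet> S = X \<bullet> (A k ** S ** A m)"
      by (subst inner_matrix_mult_right, subst inner_matrix_mult_left)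
        (use assms(1,2) in \<open>simp add: A_word\<close>)
    moreover have "(A m ** A k ** X) \<bullet> S = X \<bullet> (A k ** A m ** S)"
      by (subst inner_matrix_mult_left)
        (use assms(1,2) in \<open>simp add: matrix_transpose_mul A_word\<close>)
    ultimately show ?thesis using inner_skew_symmetric[OF skew that] by (simp add: inner_add_left)
  qed
  show "X \<bullet> (A m ** A k) = 0"
    using *[of "mat 1"] assms(1-3) by (simp add: A_anticommute[of k m])
  assume i: "i \<in> {1..7}" "i \<noteq> k" "i \<noteq> m"
  \<comment> \<open>Reversing three anticommuting letters gives a sign -1, and so do the three
    transposes together.\<close>
  have "transpose (A k ** A i ** A m) = A k ** A i ** A m"
    using assms(1-3) i by (simp add: matrix_transpose_mul A_word A_anticommute[of m k]
        A_anticommute'[of i k] A_anticommute'[of m i])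
  from *[OF this] show "X \<bullet> A i = 0"
    using assms(1-3) i by (simp add: A_word A_anticommute'[of m k] A_anticommute'[of m i])
qed

end

subsection \<open>Orthogonal subriemannian isometries\<close>

lemma Ck_on_const: "Ck_on k U (\<lambda>x. c)"
  by (induction k arbitrary: c) simp_all

text \<open>A bounded linear map is its own derivative everywhere, so each directional derivative is
  constant in the base point.\<close>

lemma Ck_on_bounded_linear: "bounded_linear f \<Longrightarrow> Ck_on k U f"
proof (cases k)
  case 0
  assume "bounded_linear f"
  then show ?thesis using 0 by (simp add: linear_continuous_on)
next
  case (Suc n)
  assume f: "bounded_linear f"
  have "frechet_derivative f (at x) = f" for x
    using bounded_linear_imp_has_derivative[OF f] frechet_derivative_at by metis
  then show ?thesis
    using Suc f by (auto simp: Ck_on_const bounded_linear_imp_differentiable)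
qed

lemma smooth_on_sphere_bounded_linear:
  assumes "bounded_linear F" "\<And>q. q \<in> sphere 0 1 \<Longrightarrow> F q = f q"
  shows "smooth_on_sphere f"
  unfolding smooth_on_sphere_def using assms Ck_on_bounded_linear
  by (intro exI[of _ UNIV] exI[of _ F]) auto

lemma orthogonal_matrix_inner:
  assumes "orthogonal_matrix Q"
  shows "(Q *v x) \<bullet> (Q *v y) = x \<bullet> (y :: real^'n)"
  using assms by (subst inner_matrix_vector_mult) (simp add: matrix_vector_mul_assoc orthogonal_matrix del: transpose_matrix_vector)

lemma orthogonal_matrix_norm:
  "orthogonal_matrix Q \<Longrightarrow> norm (Q *v x) = norm (x :: real^'n)"
  by (simp add: norm_eq_sqrt_inner orthogonal_matrix_inner)

lemma sphere_diffeo_orthogonal_matrix: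
  fixes Q :: "real^'n^'n"
  assumes Q: "orthogonal_matrix Q"
  shows "sphere_diffeo (\<lambda>q. Q *v q)"
proof -
  have Q': "orthogonal_matrix (transpose Q)" using Q by simp
  have inv: "transpose Q *v (Q *v q) = q" "Q *v (transpose Q *v q) = q" for q
    using Q by (simp_all add: matrix_vector_mul_assoc orthogonal_matrix_def del: transpose_matrix_vector)
  have bij: "bij_betw (\<lambda>q. Q *v q) (sphere 0 1) (sphere 0 1)"
    by (rule bij_betwI[where g = "\<lambda>q. transpose Q *v q"])
      (auto simp: inv orthogonal_matrix_norm[OF Q] orthogonal_matrix_norm[OF Q'] simp del: transpose_matrix_vector)
  \<comment> \<open>The inverse agrees with the transpose on the sphere, and
    \<open>smooth_on_sphere\<close> depends on values there only.\<close>
  have "transpose Q *v q = inv_into (sphere 0 1) (\<lambda>q. Q *v q) q" if "q \<in> sphere 0 1" for q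
  proof (rule inv_into_f_eq[symmetric])
    show "inj_on (\<lambda>q. Q *v q) (sphere 0 1)" using bij by (rule bij_betw_imp_inj_on)
    show "transpose Q *v q \<in> sphere 0 1"
      using that orthogonal_matrix_norm[OF Q'] by (simp del: transpose_matrix_vector)
  qed (rule inv)
  then show ?thesis unfolding sphere_diffeo_def
    using bij smooth_on_sphere_bounded_linear[OF matrix_vector_mul_bounded_linear[of Q]]
      smooth_on_sphere_bounded_linear[OF matrix_vector_mul_bounded_linear[of "transpose Q"]]
    by blast
qed

lemma sr_isometry_orthogonalI:
  fixes Q :: "real^'n^'n"
  assumes "orthogonal_matrix Q"
    and "\<And>q u. q \<in> sphere 0 1 \<Longrightarrow> u \<in> H q \<Longrightarrow> Q *v u \<in> H (Q *v q)"
  shows "sr_isometry H (\<lambda>q. Q *v q)"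
  unfolding sr_isometry_def
proof (intro conjI ballI)
  fix q :: "real^'n" assume "q \<in> sphere 0 1"
  have "((\<lambda>q. Q *v q) has_derivative (\<lambda>u. Q *v u)) (at q within sphere 0 1)"
    by (intro bounded_linear_imp_has_derivative matrix_vector_mul_bounded_linear)
  then show "\<exists>D. ((\<lambda>q. Q *v q) has_derivative D) (at q within sphere 0 1) \<and>
      D ` H q \<subseteq> H (Q *v q) \<and> (\<forall>u\<in>H q. \<forall>v\<in>H q. D u \<bullet> D v = u \<bullet> v)"
    using assms \<open>q \<in> sphere 0 1\<close>
    by (intro exI[of _ "\<lambda>u. Q *v u"]) (auto simp: orthogonal_matrix_inner)
qed (rule sphere_diffeo_orthogonal_matrix[OF assms(1)])

text \<open>A great circle through \<open>q\<close> with initial velocity \<open>u\<close> determines the derivative within the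
  sphere on \<open>u\<close>.\<close>

lemma has_derivative_within_sphere_tangent:
  fixes f :: "'a::euclidean_space \<Rightarrow> 'b::real_normed_vector"
  assumes f: "bounded_linear f" and D: "(f has_derivative D) (at q within sphere 0 1)"
    and q: "q \<in> sphere 0 1" and u: "u \<bullet> q = 0"
  shows "D u = f u"
proof (cases "u = 0")
  case True
  then show ?thesis
    using f has_derivative_bounded_linear[OF D] by (simp add: bounded_linear.linear linear_0)
next
  case False
  define r where "r = norm u"
  define \<gamma> where "\<gamma> s = cos (s * r) *\<^sub>R q + (sin (s * r) / r) *\<^sub>R u" for s
  have r: "r \<noteq> 0" "u \<bullet> u = r * r"
    using False by (simp_all add: r_def dot_square_norm power2_eq_square)
  have \<gamma>0: "\<gamma> 0 = q" by (simp add: \<gamma>_def)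
  have "\<gamma> s \<bullet> \<gamma> s = 1" for s
  proof -
    have "q \<bullet> q = 1" using q by (simp add: dot_square_norm)
    then have "\<gamma> s \<bullet> \<gamma> s = cos (s * r) * cos (s * r) + sin (s * r) * sin (s * r)"
      using r u by (simp add: \<gamma>_def inner_simps inner_commute[of q u])
    then show ?thesis using sin_cos_squared_add3[of "s * r"] by simp
  qed
  then have \<gamma>: "\<gamma> ` UNIV \<subseteq> sphere 0 1" by (auto simp: norm_eq_sqrt_inner)
  have d: "(\<gamma> has_derivative (\<lambda>h. h *\<^sub>R u)) (at 0)"
    unfolding \<gamma>_def[abs_def] using r by (auto intro!: derivative_eq_intros simp: fun_eq_iff)
  have "(f has_derivative D) (at (\<gamma> 0) within \<gamma> ` UNIV)"
    using D \<gamma> by (auto simp: \<gamma>0 intro: has_derivative_subset)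
  from has_derivative_in_compose[OF d this]
  have "((\<lambda>s. f (\<gamma> s)) has_derivative (\<lambda>h. D (h *\<^sub>R u))) (at 0)" .
  moreover have "((\<lambda>s. f (\<gamma> s)) has_derivative (\<lambda>h. f (h *\<^sub>R u))) (at 0)"
    by (rule bounded_linear.has_derivative[OF f d])
  ultimately have "(\<lambda>h. D (h *\<^sub>R u)) = (\<lambda>h. f (h *\<^sub>R u))"
    by (rule has_derivative_unique)
  from fun_cong[OF this, of 1] show ?thesis by simp
qed

text \<open>\<open>sr_isometry\<close> supplies only some derivative within the sphere; it agrees
  with \<open>Q\<close> on \<open>u\<close> because \<open>u\<close> is tangent.\<close>

lemma sr_isometry_orthogonalD:
  fixes Q :: "real^'n^'n"
  assumes "sr_isometry H (\<lambda>q. Q *v q)" "q \<in> sphere 0 1" "u \<in> H q" "u \<bullet> q = 0"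
  shows "Q *v u \<in> H (Q *v q)"
proof -
  obtain D where D: "((\<lambda>q. Q *v q) has_derivative D) (at q within sphere 0 1)" "D ` H q \<subseteq> H (Q *v q)"
    using assms(1,2) unfolding sr_isometry_def by blast
  have "D u = Q *v u"
    by (rule has_derivative_within_sphere_tangent[OF matrix_vector_mul_bounded_linear D(1) assms(2,4)])
  then show ?thesis using D(2) assms(3) by (metis image_subset_iff)
qed

section \<open>Exponentials of \<open>h5\<close> preserve the distribution\<close>

context clifford
begin

text \<open>The distribution consists of one fixed space of matrices evaluated at \<open>q\<close>,
  so its invariance can be checked on matrices.\<close>

lemma dist4_eq: "dist4 A q = (\<lambda>M. M *v q) ` span (A ` {1..4})"
proof -
  have "{A i *v q | i. i \<in> {1..4}} = (\<lambda>M. M *v q) ` A ` {1..4}" by blast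
  then show ?thesis
    unfolding dist4_def
    by (simp only: linear_span_image[OF bounded_linear.linear[OF mv.bounded_linear_left]])
qed

text \<open>The common squared norm of the \<open>A i\<close>, equal to 8.\<close>

abbreviation N :: real where "N \<equiv> mat 1 \<bullet> (mat 1 :: real^8^8)"

lemma N_pos: "N > 0"
proof -
  have "(mat 1 :: real^8^8) \<noteq> 0"
  proof
    assume "(mat 1 :: real^8^8) = 0"
    then have "(mat 1 :: real^8^8) $ 1 $ 1 = (0 :: real^8^8) $ 1 $ 1" by (rule arg_cong)
    then show False by (simp add: mat_def)
  qed
  then show ?thesis by simp
qed

lemma inner_A_A: "i \<in> {1..7} \<Longrightarrow> j \<in> {1..7} \<Longrightarrow> A i \<bullet> A j = (if i = j then N else 0)"
  by (simp add: inner_A inner_A_self)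

lemma span_A_expansion:
  assumes "Y \<in> span (A ` {1..4})"
  shows "Y = (\<Sum>j\<in>{1..4}. (Y \<bullet> A j / N) *\<^sub>R A j)"
  using assms
proof (induction rule: span_induct_alt)
  case (step c x y)
  then obtain i where i: "i \<in> {1..4}" "x = A i" by blast
  have "(\<Sum>j\<in>{1..4}. (x \<bullet> A j / N) *\<^sub>R A j) = (\<Sum>j\<in>{1..4}. if i = j then A j else 0)"
    using i N_pos by (intro sum.cong) (auto simp: inner_A_A)
  also have "\<dots> = x" using i by simp
  finally have "(\<Sum>j\<in>{1..4}. ((c *\<^sub>R x) \<bullet> A j / N) *\<^sub>R A j) = c *\<^sub>R x"
    by (simp add: scaleR_sum_right[symmetric] scaleR_scaleR[symmetric] times_divide_eq_right[symmetric]
        del: scaleR_scaleR times_divide_eq_right)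
  then show ?case
    using step.IH by (simp add: inner_add_left add_divide_distrib scaleR_add_left sum.distrib)
qed simp

text \<open>With \<open>C t = exp (t X) A\<^sub>m exp (t X)\<^sup>T\<close>, the map \<open>C \<mapsto> [X, C]\<close> is skew and preserves
  the span of \<open>A 1, \<dots>, A 4\<close>, so the norm of the projection of \<open>C t\<close> to that span is constant.
  As it equals the norm of \<open>C t\<close> at \<open>t = 0\<close>, it always does.\<close>

lemma mat_exp_conjugate_A:
  assumes X: "X \<in> h5 A" and m: "m \<in> {1..4}"
  shows "mat_exp (t *\<^sub>R X) ** A m ** transpose (mat_exp (t *\<^sub>R X)) \<in> span (A ` {1..4})"
proof -
  define C where "C t = mat_exp (t *\<^sub>R X) ** A m ** transpose (mat_exp (t *\<^sub>R X))" for t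
  have so: "X \<in> so_algebra" using X h5_subset_so_algebra by blast
  then have skew: "transpose X = - X" by (simp add: so_algebra_def)
  \<comment> \<open>Up to the factor \<open>N\<close>, the coefficients of the commutator with
    \<open>X\<close> on the span of \<open>A 1\<close>, ..., \<open>A 4\<close>; they form a skew
    array.\<close>
  define x where "x i j = (X ** A i - A i ** X) \<bullet> A j" for i j
  have x: "x j i = - x i j" if "i \<in> {1..4}" "j \<in> {1..4}" for i j
  proof -
    have "x i j = X \<bullet> (A i ** A j) - X \<bullet> (A j ** A i)" if "i \<in> {1..4}" "j \<in> {1..4}" for i j
      using that unfolding x_def
      by (simp add: inner_diff_left inner_matrix_mult_right[of X "A i"] inner_matrix_mult_left[of "A i" X]
          mm.minus_left mm.minus_right)
    then show ?thesis using that by simp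
  qed
  \<comment> \<open>Up to the factor \<open>N\<close>, the coefficients of the projection of
    \<open>C t\<close> to the span. They satisfy a linear system with skew coefficients.\<close>
  define a where "a i t = C t \<bullet> A i" for i t
  have dC: "(C has_vector_derivative X ** C t - C t ** X) (at t)" for t
    using mm.has_vector_derivative[OF mm.has_vector_derivative[OF mat_exp_has_vector_derivative[of X t]
          has_vector_derivative_const[of "A m"]]
        bounded_linear.has_vector_derivative[OF bounded_linear_transpose mat_exp_has_vector_derivative[of X t]]]
    by (simp add: C_def[abs_def] matrix_transpose_mul skew mm.minus_right mm.zero_right mm.zero_left
        matrix_mul_assoc)
  have da: "(a i has_real_derivative - (\<Sum>j\<in>{1..4}. x i j / N * a j t)) (at t)" if i: "i \<in> {1..4}" for i t
  proof -
    have "(X ** C t - C t ** X) \<bullet> A i = - (C t \<bullet> (X ** A i - A i ** X))"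
      by (simp add: inner_diff_left inner_diff_right inner_matrix_mult_right[of "C t" X]
          inner_matrix_mult_left[of X "C t"] skew mm.minus_left mm.minus_right)
    also have "X ** A i - A i ** X = (\<Sum>j\<in>{1..4}. (x i j / N) *\<^sub>R A j)"
      unfolding x_def by (rule span_A_expansion[OF commutator_h5_A[OF X i]])
    also have "C t \<bullet> \<dots> = (\<Sum>j\<in>{1..4}. x i j / N * a j t)"
      by (simp add: inner_sum_right a_def)
    finally show ?thesis
      using bounded_linear.has_vector_derivative[OF bounded_linear_inner_left dC[of t], of "A i"]
      by (simp add: has_real_derivative_iff_has_vector_derivative a_def[abs_def])
  qed
  have "((\<lambda>t. \<Sum>i\<in>{1..4}. a i t * a i t) has_real_derivative 0) (at t)" for t
  proof -
    \<comment> \<open>The derivative of the sum of squares is -2 \<open>S\<close>, and skewness of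
      \<open>x\<close> forces \<open>S = - S\<close>.\<close>
    define S where "S = (\<Sum>i\<in>{1..4}. \<Sum>j\<in>{1..4}. a i t * (x i j / N * a j t))"
    have "S = (\<Sum>j\<in>{1..4}. \<Sum>i\<in>{1..4}. a i t * (x i j / N * a j t))"
      unfolding S_def by (rule sum.swap)
    also have "\<dots> = (\<Sum>j\<in>{1..4}. \<Sum>i\<in>{1..4}. - (a j t * (x j i / N * a i t)))"
    proof (intro sum.cong refl)
      fix i j :: nat assume "i \<in> {1..4}" "j \<in> {1..4}"
      from x[OF this] show "a i t * (x i j / N * a j t) = - (a j t * (x j i / N * a i t))" by simp
    qed
    also have "\<dots> = - S" by (simp add: S_def sum_negf)
    finally have "S = 0" by simp
    have "((\<lambda>t. \<Sum>i\<in>{1..4}. a i t * a i t) has_real_derivative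
        (\<Sum>i\<in>{1..4}. - (\<Sum>j\<in>{1..4}. x i j / N * a j t) * a i t
          + - (\<Sum>j\<in>{1..4}. x i j / N * a j t) * a i t)) (at t)"
      by (intro DERIV_sum DERIV_mult da)
    also have "(\<Sum>i\<in>{1..4}. - (\<Sum>j\<in>{1..4}. x i j / N * a j t) * a i t
          + - (\<Sum>j\<in>{1..4}. x i j / N * a j t) * a i t) = - 2 * S"
      by (simp add: S_def sum_distrib_left sum_distrib_right sum.distrib sum_negf sum_subtractf mult_ac)
    finally show ?thesis using \<open>S = 0\<close> by simp
  qed
  then have "(\<Sum>i\<in>{1..4}. a i t * a i t) = (\<Sum>i\<in>{1..4}. a i 0 * a i 0)"
    by (intro vector_derivative_zero_imp_constant) (simp add: has_real_derivative_iff_has_vector_derivative)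
  also have "\<dots> = (\<Sum>i\<in>{1..4}. if m = i then N * N else 0)"
    using m by (intro sum.cong) (auto simp: a_def C_def inner_A_A)
  also have "\<dots> = N * N" using m by simp
  finally have aa: "(\<Sum>i\<in>{1..4}. a i t * a i t) = N * N" .
  have CC: "C t \<bullet> C t = N"
  proof -
    have o: "transpose (mat_exp (t *\<^sub>R X)) ** mat_exp (t *\<^sub>R X) = mat 1"
      using orthogonal_matrix_mat_exp[OF so] by (simp add: orthogonal_matrix)
    then have o': "Z ** transpose (mat_exp (t *\<^sub>R X)) ** mat_exp (t *\<^sub>R X) = Z" for Z :: "real^8^8"
      by (simp flip: matrix_mul_assoc)
    have "C t \<bullet> C t = A m \<bullet> A m"
      unfolding C_def
      by (subst inner_matrix_mult_right, subst inner_matrix_mult_left) (simp add: matrix_mul_assoc o o')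
    then show ?thesis using m by (simp add: inner_A_self)
  qed
  \<comment> \<open>The orthogonal projection of \<open>C t\<close>. All inner products among
    \<open>C t\<close> and \<open>W\<close> equal \<open>N\<close>, so their difference has squared
    norm N - 2N + N = 0.\<close>
  define W where "W = (\<Sum>i\<in>{1..4}. (a i t / N) *\<^sub>R A i)"
  have CW: "C t \<bullet> W = N"
  proof -
    have "C t \<bullet> W = (\<Sum>i\<in>{1..4}. a i t * a i t) / N"
      by (simp add: W_def inner_sum_right a_def sum_divide_distrib)
    then show ?thesis using aa N_pos by simp
  qed
  have "A i \<bullet> W = a i t" if "i \<in> {1..4}" for i
  proof -
    have "A i \<bullet> W = (\<Sum>j\<in>{1..4}. if i = j then a j t else 0)"
      unfolding W_def inner_sum_right using that N_pos by (intro sum.cong) (auto simp: inner_A_A)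
    then show ?thesis using that by simp
  qed
  then have "W \<bullet> W = (\<Sum>i\<in>{1..4}. a i t * a i t) / N"
    by (subst W_def) (simp add: inner_sum_left sum_divide_distrib)
  then have "W \<bullet> W = N" using aa N_pos by simp
  then have "(C t - W) \<bullet> (C t - W) = 0"
    using CC CW by (simp add: inner_diff_left inner_diff_right inner_commute[of W "C t"])
  then have "C t = W" by simp
  moreover have "W \<in> span (A ` {1..4})"
    unfolding W_def by (intro span_sum span_scale span_base) auto
  ultimately show ?thesis by (simp add: C_def)
qed

text \<open>For orthogonal Q, Q (M q) = (Q M Q^T) (Q q), so invariance of the matrix span under
  conjugation becomes invariance of the distribution.\<close>

lemma sr_isometry_mat_exp:
  assumes "X \<in> h5 A"
  shows "sr_isometry (dist4 A) (\<lambda>q. mat_exp (t *\<^sub>R X) *v q)"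
proof -
  define Q where "Q = mat_exp (t *\<^sub>R X)"
  have Q: "orthogonal_matrix Q"
    unfolding Q_def using assms h5_subset_so_algebra by (intro orthogonal_matrix_mat_exp) auto
  have lin: "linear (\<lambda>M. Q ** M ** transpose Q)"
    by (intro bounded_linear.linear bounded_linear_compose[OF mm.bounded_linear_left mm.bounded_linear_right])
  have conj: "Q ** M ** transpose Q \<in> span (A ` {1..4})" if "M \<in> span (A ` {1..4})" for M
  proof -
    have "(\<lambda>M. Q ** M ** transpose Q) ` A ` {1..4} \<subseteq> span (A ` {1..4})"
      using mat_exp_conjugate_A[OF assms] by (auto simp: Q_def)
    then have "span ((\<lambda>M. Q ** M ** transpose Q) ` A ` {1..4}) \<subseteq> span (A ` {1..4})"
      by (intro span_minimal) auto
    then show ?thesis using linear_span_image[OF lin] that by blast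
  qed
  have "Q *v u \<in> dist4 A (Q *v q)" if "u \<in> dist4 A q" for q u
  proof -
    obtain M where M: "M \<in> span (A ` {1..4})" "u = M *v q" using \<open>u \<in> dist4 A q\<close> by (auto simp: dist4_eq)
    have "(Q ** M ** transpose Q) *v (Q *v q) = (Q ** M ** (transpose Q ** Q)) *v q"
      by (simp only: matrix_vector_mul_assoc matrix_mul_assoc)
    also have "\<dots> = Q *v u"
      using Q by (simp add: orthogonal_matrix M(2) matrix_vector_mul_assoc)
    finally show ?thesis using conj[OF M(1)] by (auto simp: dist4_eq intro: rev_image_eqI)
  qed
  then show ?thesis using sr_isometry_orthogonalI[OF Q] by (simp add: Q_def)
qed

section \<open>The converse inclusion\<close>

text \<open>\<open>A k\<close> and \<open>A i\<close> are skew and anticommute, so the inner product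
  of A_k p and A_i p equals its own negative. This provides vectors normal to the
  distribution.\<close>

lemma A_inner_dist4:
  assumes "k \<in> {5..7}" "v \<in> dist4 A p"
  shows "(A k *v p) \<bullet> v = 0"
proof -
  have "{v. (A k *v p) \<bullet> v = 0} \<supseteq> {A i *v p | i. i \<in> {1..4}}"
  proof safe
    fix i :: nat assume i: "i \<in> {1..4}"
    have ik: "i \<in> {1..7}" "k \<in> {1..7}" "i \<noteq> k" using i assms(1) by auto
    have "(A k *v p) \<bullet> (A i *v p) = - (p \<bullet> ((A k ** A i) *v p))"
      using ik by (subst inner_matrix_vector_mult)
        (simp add: mv.minus_left mm.minus_left matrix_vector_mul_assoc del: transpose_matrix_vector)
    moreover have "(A i *v p) \<bullet> (A k *v p) = p \<bullet> ((A k ** A i) *v p)"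
      using ik by (subst inner_matrix_vector_mult)
        (simp add: mv.minus_left mm.minus_left matrix_vector_mul_assoc A_anticommute[of i k] del: transpose_matrix_vector)
    ultimately show "(A k *v p) \<bullet> (A i *v p) = 0" by (simp add: inner_commute)
  qed
  then have "span {A i *v p | i. i \<in> {1..4}} \<subseteq> {v. (A k *v p) \<bullet> v = 0}"
    by (rule span_minimal) (rule subspace_hyperplane)
  then show ?thesis using assms(2) by (auto simp: dist4_def)
qed

lemma lie_algebra_skew:
  assumes X: "X \<in> matrix_lie_algebra (sr_isometries_orthogonal (dist4 A))"
    and m: "m \<in> {1..4}" and k: "k \<in> {5..7}"
  shows "transpose (A k ** X ** A m + A m ** A k ** X) = - (A k ** X ** A m + A m ** A k ** X)"
proof (rule quadratic_form_zero_imp_skew)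
  define M where "M = A k ** X ** A m + A m ** A k ** X"
  have mk: "m \<in> {1..7}" "k \<in> {1..7}" using m k by auto
  have tr: "(A i *v p) \<bullet> q = - (p \<bullet> (A i *v q))" if "i \<in> {1..7}" for i p q
    using that by (simp add: inner_matrix_vector_mult mv.minus_left del: transpose_matrix_vector)
  have "(M *v q) \<bullet> q = 0" if q: "q \<in> sphere 0 1" for q
  proof -
    define E where "E t = mat_exp (t *\<^sub>R X)" for t
    have tangent: "(A m *v q) \<bullet> q = 0" using tr[of m q q] mk by (simp add: inner_commute)
    have "A m *v q \<in> dist4 A q" unfolding dist4_def using m by (intro span_base) blast
    then have "E t *v (A m *v q) \<in> dist4 A (E t *v q)" for t
      using X tangent q sr_isometry_orthogonalD[of "dist4 A" "E t" q "A m *v q"]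
      by (simp add: matrix_lie_algebra_def sr_isometries_orthogonal_def E_def)
    then have 0: "(A k *v (E t *v q)) \<bullet> (E t *v (A m *v q)) = 0" for t
      using A_inner_dist4[OF k] by blast
    have E: "((\<lambda>t. E t *v v) has_vector_derivative X *v v) (at 0)" for v
      using bounded_linear.has_vector_derivative[OF mv.bounded_linear_left mat_exp_has_vector_derivative[of X 0]]
      by (simp add: E_def)
    have "((\<lambda>t. (A k *v (E t *v q)) \<bullet> (E t *v (A m *v q))) has_vector_derivative
        (A k *v q) \<bullet> (X *v (A m *v q)) + (A k *v (X *v q)) \<bullet> (A m *v q)) (at 0)"
      using bounded_bilinear.has_vector_derivative[OF bounded_bilinear_inner
          bounded_linear.has_vector_derivative[OF mv.bounded_linear_right E] E, of "A k" q "A m *v q"]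
      by (simp add: E_def)
    \<comment> \<open>The differentiated function is identically zero by \<open>0\<close>. Skewness
      of \<open>A k\<close> and \<open>A m\<close> turns its derivative into the negative of the
      quadratic form of \<open>M\<close> at \<open>q\<close>.\<close>
    then have "(A k *v q) \<bullet> (X *v (A m *v q)) + (A k *v (X *v q)) \<bullet> (A m *v q) = 0"
      unfolding 0 by (metis has_vector_derivative_const vector_derivative_unique_at)
    then show ?thesis
      using mk by (simp add: M_def matrix_vector_mult_add_rdistrib inner_add_left inner_add_right tr
          inner_commute flip: matrix_vector_mul_assoc)
  qed
  \<comment> \<open>Homogeneity extends the identity from the unit sphere to every
    \<open>q\<close>.\<close>
  then have unit: "(M *v sgn q) \<bullet> sgn q = 0" if "q \<noteq> 0" for q
    using that by (simp add: norm_sgn)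
  show "((A k ** X ** A m + A m ** A k ** X) *v q) \<bullet> q = 0" for q
  proof (cases "q = 0")
    case False
    then show ?thesis using unit[of q] by (simp add: sgn_div_norm mv.scaleR_right M_def)
  qed simp
qed

lemma lie_algebra_eq_h5: "matrix_lie_algebra (sr_isometries_orthogonal (dist4 A)) = h5 A"
proof (intro subset_antisym subsetI)
  fix X assume X: "X \<in> matrix_lie_algebra (sr_isometries_orthogonal (dist4 A))"
  show "X \<in> h5 A"
  proof (rule mem_h5I)
    show "X \<in> so_algebra"
      using X by (intro orthogonal_mat_exp_imp_so_algebra)
        (simp add: matrix_lie_algebra_def sr_isometries_orthogonal_def)
    fix m k :: nat assume "m \<in> {1..4}" "k \<in> {5..7}"
    then show "X \<bullet> (A m ** A k) = 0"
      using lie_algebra_skew[OF X] by (intro orthogonal_of_skew(1)) auto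
  next
    fix i :: nat assume i: "i \<in> {1..7}"
    \<comment> \<open>Each of the blocks 1..4 and 5..7 has an index different from i.\<close>
    define m k :: nat where "m = (if i = 1 then 2 else 1)" and "k = (if i = 5 then 6 else 5)"
    have "m \<in> {1..4}" "k \<in> {5..7}" "i \<noteq> k" "i \<noteq> m" by (auto simp: m_def k_def)
    then show "X \<bullet> A i = 0"
      using lie_algebra_skew[OF X] i by (intro orthogonal_of_skew(2)[of k m]) auto
  qed
next
  fix X assume X: "X \<in> h5 A"
  then have "X \<in> so_algebra" using h5_subset_so_algebra by blast
  with X show "X \<in> matrix_lie_algebra (sr_isometries_orthogonal (dist4 A))"
    using sr_isometry_mat_exp orthogonal_matrix_mat_exp[of X]
    by (simp add: matrix_lie_algebra_def sr_isometries_orthogonal_def)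
qed

section \<open>Killing fields and the dimension bound\<close>

lemma sr_killing_field_h5:
  assumes "X \<in> h5 A"
  shows "sr_killing_field (dist4 A) (\<lambda>q. X *v q)"
  unfolding sr_killing_field_def
proof (intro conjI exI[of _ "\<lambda>t q. mat_exp (t *\<^sub>R X) *v q"] allI ballI)
  show "smooth_on_sphere (\<lambda>q. X *v q)"
    by (rule smooth_on_sphere_bounded_linear[OF matrix_vector_mul_bounded_linear]) simp
  show "sr_isometry (dist4 A) (\<lambda>q. mat_exp (t *\<^sub>R X) *v q)" for t
    by (rule sr_isometry_mat_exp[OF assms])
  show "mat_exp ((s + t) *\<^sub>R X) *v q = mat_exp (s *\<^sub>R X) *v (mat_exp (t *\<^sub>R X) *v q)" for s t q
    by (simp only: mat_exp_add matrix_vector_mul_assoc)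
  show "((\<lambda>t. mat_exp (t *\<^sub>R X) *v q) has_vector_derivative X *v (mat_exp (t *\<^sub>R X) *v q)) (at t)" for t q
    using bounded_linear.has_vector_derivative[OF mv.bounded_linear_left mat_exp_has_vector_derivative[of X t]]
    by (simp add: matrix_vector_mul_assoc)
qed simp

text \<open>A basis of \<open>h5\<close> gives linear Killing fields. A combination that vanishes on
  the sphere vanishes at the axis vectors, hence is the zero matrix, and independence of the basis
  applies.\<close>

lemma sr_isometry_group_dim_ge: "enat (dim (h5 A)) \<le> sr_isometry_group_dim (dist4 A)"
proof -
  obtain B where B: "B \<subseteq> h5 A" "independent B" "card B = dim (h5 A)"
    using basis_exists by metis
  have "finite B" using B(2) by (rule independent_imp_finite)
  then obtain f where f: "bij_betw f {..<dim (h5 A)} B"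
    using ex_bij_betw_nat_finite[of B] B(3) by (auto simp: atLeast0LessThan)
  have "c i = 0"
    if zero: "\<forall>q\<in>sphere 0 1. (\<Sum>i<dim (h5 A). c i *\<^sub>R (f i *v q)) = 0" and i: "i < dim (h5 A)" for c i
  proof -
    define M where "M = (\<Sum>i<dim (h5 A). c i *\<^sub>R f i)"
    have M: "M *v q = (\<Sum>i<dim (h5 A). c i *\<^sub>R (f i *v q))" for q
      by (simp add: M_def mv.sum_left mv.scaleR_left)
    have "M *v axis j 1 = 0" for j
      unfolding M using zero by simp
    then have "column j M = 0" for j by (simp add: matrix_vector_mult_basis)
    then have "M = 0" by (simp add: vec_eq_iff column_def)
    \<comment> \<open>Independence of \<open>B\<close> concerns coefficients indexed by its
      elements, so \<open>c\<close> is transported along the inverse of the enumeration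
      \<open>f\<close>.\<close>
    moreover have "M = (\<Sum>b\<in>B. c (inv_into {..<dim (h5 A)} f b) *\<^sub>R b)"
    proof -
      have "(\<Sum>b\<in>B. c (inv_into {..<dim (h5 A)} f b) *\<^sub>R b)
          = (\<Sum>i<dim (h5 A). c (inv_into {..<dim (h5 A)} f (f i)) *\<^sub>R f i)"
        by (rule sum.reindex_bij_betw[OF f, symmetric])
      also have "\<dots> = M"
        unfolding M_def using f by (intro sum.cong) (auto simp: bij_betw_inv_into_left)
      finally show ?thesis by simp
    qed
    moreover have "f i \<in> B" using f i by (auto simp: bij_betw_def)
    ultimately have "c (inv_into {..<dim (h5 A)} f (f i)) = 0"
      using independentD[OF B(2) \<open>finite B\<close> subset_refl, of "\<lambda>b. c (inv_into {..<dim (h5 A)} f b)" "f i"]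
      by simp
    then show ?thesis using f i by (simp add: bij_betw_inv_into_left)
  qed
  moreover have "\<forall>i<dim (h5 A). sr_killing_field (dist4 A) (\<lambda>q. f i *v q)"
    using f B(1) by (auto intro!: sr_killing_field_h5 simp: bij_betw_def)
  ultimately show ?thesis
    unfolding sr_isometry_group_dim_def
    by (intro SUP_upper CollectI exI[of _ "\<lambda>i q. f i *v q"]) auto
qed

end

theorem theorem5p9:
  fixes A :: "nat \<Rightarrow> real^8^8"
  assumes "clifford_family A"
  shows "matrix_lie_algebra (sr_isometries_orthogonal (dist4 A)) = h5 A
    \<and> h5 A \<subseteq> so_algebra
    \<and> sr_isometry_group_dim (dist4 A) \<ge> enat (dim (h5 A))
    \<and> dim (h5 A) = 9"
proof -
  interpret clifford A using assms by unfold_locales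
  show ?thesis
    using lie_algebra_eq_h5 h5_subset_so_algebra sr_isometry_group_dim_ge dim_h5 by blast
qed

end
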